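(* Let $b\in\mathbb{R}$, $D^+=(-\infty,b]$, $D\subseteq D^+$, $n\ge1$ and $\alpha\in(0,1)$. Let $\boldsymbol{\ell}\in[0,1]^n$ be a vector such that $G_{\mathbf{X},\boldsymbol{\ell}}$ is an exact $(1-\alpha)$ lower confidence bound for the CDF. Let $b^{\alpha,\text{Anderson}}_{\boldsymbol{\ell}}(\mathbf{x})=m_{D^+}(\mathbf{x},\boldsymbol{\ell})$. Then for every $\mathbf{x}\in D^n$, using the function $T(\mathbf{y})=b^{\alpha,\text{Anderson}}_{\boldsymbol{\ell}}(\mathbf{y})$ yields $$b^{\alpha}_{D^+,T}(\mathbf{x})\le b^{\alpha,\text{Anderson}}_{\boldsymbol{\ell}}(\mathbf{x}).$$
   Context: For a vector $\mathbf{v}\in\mathbb{R}^n$ let $v_{(1)}\le\dots\le v_{(n)}$ denote its sorted entries. Let $E\subset\mathbb{R}$ with $s_E=\sup E<\infty$ (here $E=D^+$). For $\mathbf{x}\in E^n$ and $\boldsymbol{\ell}\in[0,1]^n$, with the conventions $\ell_{(0)}=0$, $\ell_{(n+1)}=1$, $x_{(n+1)}=s_E$, put $$m_E(\mathbf{x},\boldsymbol{\ell})=\sum_{i=1}^{n+1}x_{(i)}(\ell_{(i)}-\ell_{(i-1)})=s_E-\sum_{i=1}^n \ell_{(i)}(x_{(i+1)}-x_{(i)}).$$ $G_{\mathbf{x},\boldsymbol{\ell}}:\mathbb{R}\to[0,1]$ is the step function equal to $0$ for $x<x_{(1)}$, to $\ell_{(i)}$ for $x_{(i)}\le x<x_{(i+1)}$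 ($1\le i\le n$), and to $1$ for $x\ge s_E$. For $T:E^n\to\mathbb{R}$ and $\mathbf{x}\in E^n$ let $\mathbb{S}_{E,T}(\mathbf{x})=\{\mathbf{y}\in E^n:T(\mathbf{y})\le T(\mathbf{x})\}$ and $b_{E,T}(\mathbf{x},\mathbf{u})=\sup_{\mathbf{z}\in\mathbb{S}_{E,T}(\mathbf{x})}m_E(\mathbf{z},\mathbf{u})$ for $\mathbf{u}\in[0,1]^n$. Let $\mathbf{U}$ have $n$ i.i.d. uniform$[0,1]$ entries. With $Q(p,Y)=\inf\{y\in\mathbb{R}:F_Y(y)\ge p\}$ the quantile function of a random variable $Y$ with CDF $F_Y$, define $b^{\alpha}_{E,T}(\mathbf{x})=Q(1-\alpha,b_{E,T}(\mathbf{x},\mathbf{U}))$. Lower confidence bound: a function $H_{\mathbf{X}}:\mathbb{R}\to[0,1]$ computed from an i.i.d. sample $\mathbf{X}=(X_1,\dots,X_n)$ is a $(1-\alpha)$ lower confidence bound for the CDF if for every CDF $F$ of a distribution on $D^+$, when $\mathbf{X}$ is sampled from $F$, $\mathbb{P}_{\mathbf{X}}(\forall x\in\mathbb{R},\ F(x)\ge H_{\mathbf{X}}(x))\ge 1-\alpha$. It is exact if in addition there exists such an $F$ for which this probability equals $1-\alpha$. *)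

theory Defs
  imports "HOL-Probability.Probability"
begin

text \<open>
  Vectors in \<open>E\<^sup>n\<close> are the elements of \<open>{1..n} \<rightarrow>\<^sub>E E\<close>, the carrier of the product
  measures \<open>\<Pi>\<^sub>M i\<in>{1..n}. \<mu>\<close>.
\<close>

text \<open>\<open>v\<^bsub>(i)\<^esub>\<close> for \<open>1 \<le> i \<le> n\<close>; the list index is shifted because lists count from 0.\<close>

definition order_stat :: "nat \<Rightarrow> (nat \<Rightarrow> real) \<Rightarrow> nat \<Rightarrow> real" where
  "order_stat n v i = sort (map v [1..<Suc n]) ! (i - 1)"

text \<open>Order statistics with the boundary conventions \<open>\<ell>\<^bsub>(0)\<^esub> = 0\<close>, \<open>\<ell>\<^bsub>(n+1)\<^esub> = 1\<close>
  and \<open>x\<^bsub>(n+1)\<^esub> = sup E\<close>. The value \<open>x\<^bsub>(0)\<^esub>\<close> is never used.\<close>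

definition level :: "nat \<Rightarrow> (nat \<Rightarrow> real) \<Rightarrow> nat \<Rightarrow> real" where
  "level n l i = (if i = 0 then 0 else if i \<le> n then order_stat n l i else 1)"

definition point :: "real set \<Rightarrow> nat \<Rightarrow> (nat \<Rightarrow> real) \<Rightarrow> nat \<Rightarrow> real" where
  "point E n x i = (if i \<le> n then order_stat n x i else Sup E)"

definition induced_mean :: "real set \<Rightarrow> nat \<Rightarrow> (nat \<Rightarrow> real) \<Rightarrow> (nat \<Rightarrow> real) \<Rightarrow> real" where
  "induced_mean E n x l =
     (\<Sum>i=1..n+1. point E n x i * (level n l i - level n l (i - 1)))"

lemma induced_mean_alt:
  assumes "1 \<le> n"
  shows "induced_mean E n x l =
    Sup E - (\<Sum>i=1..n. order_stat n l i * (point E n x (i + 1) - point E n x i))"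
proof -
  have parts: "(\<Sum>i=1..m+1. p i * (q i - q (i - 1)))
      = p (m+1) * q (m+1) - p 1 * q 0 - (\<Sum>i=1..m. q i * (p (i+1) - p i))"
    for m and p q :: "nat \<Rightarrow> real"
    by (induction m) (simp_all add: algebra_simps)
  have "(\<Sum>i=1..n. level n l i * (point E n x (i + 1) - point E n x i))
      = (\<Sum>i=1..n. order_stat n l i * (point E n x (i + 1) - point E n x i))"
    by (rule sum.cong) (auto simp: level_def)
  then show ?thesis
    unfolding induced_mean_def parts[of "point E n x" "level n l" n]
    by (simp add: level_def point_def)
qed

text \<open>The step function \<open>G\<close>; the interval \<open>[x\<^bsub>(i)\<^esub>, x\<^bsub>(i+1)\<^esub>)\<close> containing \<open>t\<close> is unique,
  also in the presence of ties (see \<open>step_bound_mid\<close> below).\<close>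

definition step_bound :: "real set \<Rightarrow> nat \<Rightarrow> (nat \<Rightarrow> real) \<Rightarrow> (nat \<Rightarrow> real) \<Rightarrow> real \<Rightarrow> real" where
  "step_bound E n x l t =
     (if t \<ge> Sup E then 1
      else if t < order_stat n x 1 then 0
      else order_stat n l (THE i. i \<in> {1..n} \<and> point E n x i \<le> t \<and> t < point E n x (i + 1)))"

lemma point_mono:
  assumes "x \<in> {1..n} \<rightarrow>\<^sub>E E" "bdd_above E" "1 \<le> i" "i \<le> j" "j \<le> n + 1"
  shows "point E n x i \<le> point E n x j"
proof -
  have *: "order_stat n x k \<in> E" if "1 \<le> k" "k \<le> n" for k
  proof -
    have "order_stat n x k \<in> set (sort (map x [1..<Suc n]))"
      unfolding order_stat_def by (rule nth_mem) (use that in auto)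
    then show ?thesis using assms(1) by auto
  qed
  show ?thesis
  proof (cases "j \<le> n")
    case True
    then show ?thesis
      using assms unfolding point_def order_stat_def
      by (auto intro!: sorted_nth_mono)
  next
    case False
    then show ?thesis
      using * assms by (auto simp: point_def intro: cSup_upper)
  qed
qed

lemma step_bound_mid:
  assumes "x \<in> {1..n} \<rightarrow>\<^sub>E E" "bdd_above E" "i \<in> {1..n}"
    and t: "point E n x i \<le> t" "t < point E n x (i + 1)"
  shows "step_bound E n x l t = order_stat n l i"
proof -
  note mono = point_mono[OF assms(1,2)]
  have "t < Sup E"
    using t(2) mono[of "i+1" "n+1"] assms(3) by (auto simp: point_def split: if_splits)
  moreover have "order_stat n x 1 \<le> t"
    using t(1) mono[of 1 i] assms(3) by (auto simp: point_def)
  moreover have "(THE j. j \<in> {1..n} \<and> point E n x j \<le> t \<and> t < point E n x (j + 1)) = i"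
  proof (rule the_equality)
    fix j assume j: "j \<in> {1..n} \<and> point E n x j \<le> t \<and> t < point E n x (j + 1)"
    show "j = i"
    proof (rule ccontr)
      assume "j \<noteq> i"
      then consider "i + 1 \<le> j" | "j + 1 \<le> i" by linarith
      then show False
        using mono[of "i+1" j] mono[of "j+1" i] j t assms(3) by cases auto
    qed
  qed (use assms in auto)
  ultimately show ?thesis by (simp add: step_bound_def)
qed

text \<open>A CDF of a distribution on \<open>E\<close> is \<open>cdf \<mu>\<close> for a Borel probability measure \<open>\<mu>\<close> concentrated
  on \<open>E\<close>; an i.i.d. sample of size \<open>n\<close> from it has law \<open>\<Pi>\<^sub>M i\<in>{1..n}. \<mu>\<close>. The bound \<open>H\<close> maps
  a sample to a function \<open>\<real> \<rightarrow> [0,1]\<close>.\<close>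

definition distribution_on :: "real set \<Rightarrow> real measure \<Rightarrow> bool" where
  "distribution_on E \<mu> \<longleftrightarrow> real_distribution \<mu> \<and> (AE y in \<mu>. y \<in> E)"

definition coverage :: "nat \<Rightarrow> ((nat \<Rightarrow> real) \<Rightarrow> real \<Rightarrow> real) \<Rightarrow> real measure \<Rightarrow> real" where
  "coverage n H \<mu> =
     \<P>(x in (\<Pi>\<^sub>M i\<in>{1..n}. \<mu>). \<forall>t. cdf \<mu> t \<ge> H x t)"

definition lower_conf_bound ::
  "real set \<Rightarrow> nat \<Rightarrow> real \<Rightarrow> ((nat \<Rightarrow> real) \<Rightarrow> real \<Rightarrow> real) \<Rightarrow> bool" where
  "lower_conf_bound E n \<alpha> H \<longleftrightarrow>
     (\<forall>x \<in> {1..n} \<rightarrow>\<^sub>E E. \<forall>t. H x t \<in> {0..1}) \<and>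
     (\<forall>\<mu>. distribution_on E \<mu> \<longrightarrow> coverage n H \<mu> \<ge> 1 - \<alpha>)"

definition exact_lower_conf_bound ::
  "real set \<Rightarrow> nat \<Rightarrow> real \<Rightarrow> ((nat \<Rightarrow> real) \<Rightarrow> real \<Rightarrow> real) \<Rightarrow> bool" where
  "exact_lower_conf_bound E n \<alpha> H \<longleftrightarrow>
     lower_conf_bound E n \<alpha> H \<and>
     (\<exists>\<mu>. distribution_on E \<mu> \<and> coverage n H \<mu> = 1 - \<alpha>)"

definition sublevel ::
  "real set \<Rightarrow> nat \<Rightarrow> ((nat \<Rightarrow> real) \<Rightarrow> real) \<Rightarrow> (nat \<Rightarrow> real) \<Rightarrow> (nat \<Rightarrow> real) set" where
  "sublevel E n T x = {y \<in> {1..n} \<rightarrow>\<^sub>E E. T y \<le> T x}"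

text \<open>For \<open>u \<in> [0,1]\<^sup>n\<close> and nonempty \<open>E\<close> bounded above, the supremum ranges over a set bounded
  above by \<open>sup E\<close>. Other \<open>u\<close> form a null set for \<open>iid_uniform\<close>.\<close>

definition sup_mean ::
  "real set \<Rightarrow> nat \<Rightarrow> ((nat \<Rightarrow> real) \<Rightarrow> real) \<Rightarrow> (nat \<Rightarrow> real) \<Rightarrow> (nat \<Rightarrow> real) \<Rightarrow> real" where
  "sup_mean E n T x u = (SUP z \<in> sublevel E n T x. induced_mean E n z u)"

definition iid_uniform :: "nat \<Rightarrow> (nat \<Rightarrow> real) measure" where
  "iid_uniform n = (\<Pi>\<^sub>M i\<in>{1..n}. uniform_measure lborel {0..1})"

definition quantile :: "'a measure \<Rightarrow> real \<Rightarrow> ('a \<Rightarrow> real) \<Rightarrow> real" where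
  "quantile M p Y = Inf {y. cdf (distr M borel Y) y \<ge> p}"

definition mean_upper_bound ::
  "real set \<Rightarrow> nat \<Rightarrow> real \<Rightarrow> ((nat \<Rightarrow> real) \<Rightarrow> real) \<Rightarrow> (nat \<Rightarrow> real) \<Rightarrow> real" where
  "mean_upper_bound E n \<alpha> T x = quantile (iid_uniform n) (1 - \<alpha>) (sup_mean E n T x)"

definition anderson_bound :: "real \<Rightarrow> nat \<Rightarrow> (nat \<Rightarrow> real) \<Rightarrow> (nat \<Rightarrow> real) \<Rightarrow> real" where
  "anderson_bound b n l x = induced_mean {..b} n x l"

end

theory Submission
  imports Defs
begin

text \<open>
  Apply the coverage guarantee to the uniform distribution on \<open>[b - 1, b]\<close>: evaluating the step
  bound at the sample points shows that, with probability at least \<open>1 - \<alpha>\<close>, the order statistics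
  of the uniform vector \<open>U\<close> dominate those of \<open>l\<close>.  On that event the induced mean of any \<open>z\<close> in
  the sublevel set of \<open>x\<close> is at most its Anderson bound, hence at most the Anderson bound of \<open>x\<close>.
\<close>

section \<open>Order statistics\<close>

text \<open>Each entry of the new list is a \<open>min\<close>/\<open>max\<close> expression in
  \<open>a\<close> and two neighbouring entries of \<open>S\<close>, whatever position
  \<open>a\<close> lands in. This uniform formula is what lets continuity pass through
  sorting.\<close>

lemma insort_nth:
  fixes a :: "'a::linorder"
  assumes "sorted S" "k \<le> length S"
  shows "insort a S ! k =
    (case k of 0 \<Rightarrow> if S = [] then a else min a (S ! 0)
     | Suc j \<Rightarrow> max (S ! j) (if k < length S then min a (S ! k) else a))"
  using assms
proof (induction S arbitrary: k)
  case (Cons s S)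
  show ?case
  proof (cases k)
    case (Suc j)
    show ?thesis
    proof (cases "a \<le> s")
      case True
      have "a \<le> (s # S) ! j"
        using True Suc Cons.prems by (cases j) (auto intro: order_trans)
      then have "max ((s # S) ! j) (if k < length (s # S) then min a ((s # S) ! k) else a)
          = (s # S) ! j"
        by (intro max_absorb1) (simp add: min.coboundedI1)
      then show ?thesis using True Suc by simp
    next
      case False
      have IH: "insort a S ! j = (case j of 0 \<Rightarrow> if S = [] then a else min a (S ! 0)
          | Suc i \<Rightarrow> max (S ! i) (if j < length S then min a (S ! j) else a))"
        using Cons.prems Suc by (intro Cons.IH) auto
      \<comment> \<open>At \<open>j = 0\<close> the formula for \<open>S\<close> has no
        \<open>max\<close> with a left neighbour; taking it with \<open>s\<close> changes nothing,
        since \<open>a\<close> and the head of \<open>S\<close> are at least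
        \<open>s\<close>.\<close>
      have "max s (if S = [] then a else min a (S ! 0)) = (if S = [] then a else min a (S ! 0))"
        using False Cons.prems by (intro max_absorb2) auto
      then show ?thesis
        using False Suc IH by (cases j) auto
    qed
  qed (use Cons.prems in \<open>auto simp: min_def\<close>)
qed auto

text \<open>By induction on the index list, each sorted entry arises from the \<open>f i\<close> by
  finitely many \<open>min\<close> and \<open>max\<close> operations.\<close>

lemma continuous_on_sort_nth:
  fixes f :: "'i \<Rightarrow> 'a::topological_space \<Rightarrow> 'b::linorder_topology"
  assumes "\<And>i. continuous_on S (f i)" and "k < length is"
  shows "continuous_on S (\<lambda>u. sort (map (\<lambda>i. f i u) is) ! k)"
  using assms(2)
proof (induction "is" arbitrary: k)
  case (Cons a "is")
  have *: "sort (map (\<lambda>i. f i u) (a # is)) ! k = (case k of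
      0 \<Rightarrow> if is = [] then f a u else min (f a u) (sort (map (\<lambda>i. f i u) is) ! 0)
    | Suc j \<Rightarrow> max (sort (map (\<lambda>i. f i u) is) ! j)
        (if k < length is then min (f a u) (sort (map (\<lambda>i. f i u) is) ! k) else f a u))" for u
  proof -
    have "sort (map (\<lambda>i. f i u) is) = [] \<longleftrightarrow> is = []"
      by (metis length_0_conv length_map length_sort)
    then show ?thesis
      using insort_nth[of "sort (map (\<lambda>i. f i u) is)" k "f a u"] Cons.prems by simp
  qed
  show ?case
  proof (cases k)
    case 0
    then show ?thesis
      unfolding * using Cons.IH[of 0] assms(1)
      by (cases "is = []") (simp_all add: continuous_on_min)
  next
    case (Suc j)
    then show ?thesis
      unfolding * using Cons.IH[of j] Cons.IH[of k] Cons.prems assms(1)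
      by (cases "k < length is") (simp_all add: continuous_on_max continuous_on_min)
  qed
qed auto

lemma continuous_on_order_stat:
  assumes "i \<in> {1..n}"
  shows "continuous_on S (\<lambda>u. order_stat n u i)"
proof -
  have "continuous_on UNIV (\<lambda>u::nat \<Rightarrow> real. sort (map (\<lambda>j. u j) [1..<Suc n]) ! (i - 1))"
    using assms
    by (intro continuous_on_sort_nth[where f = "\<lambda>j u. u j"]) (auto simp del: upt_Suc)
  then show ?thesis
    unfolding order_stat_def by (auto intro: continuous_on_subset)
qed

text \<open>Applying a monotone \<open>f\<close> to the sorted list gives a sorted permutation of
  \<open>map f xs\<close>, and such a list is unique.\<close>

lemma sort_map_mono:
  assumes "mono f"
  shows "sort (map f xs) = map f (sort xs)"
  using assms
  by (intro properties_for_sort)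
    (auto simp: sorted_map mono_def intro: sorted_wrt_mono_rel[OF _ sorted_sort])

lemma order_stat_compose:
  assumes "mono f" "i \<in> {1..n}"
  shows "order_stat n (compose {1..n} f u) i = f (order_stat n u i)"
proof -
  have "map (compose {1..n} f u) [1..<Suc n] = map f (map u [1..<Suc n])"
    by (auto simp: compose_def)
  moreover have "i - 1 < length [1..<Suc n]"
    using assms(2) by (auto simp del: upt_Suc)
  ultimately show ?thesis
    unfolding order_stat_def
    by (simp only: sort_map_mono[OF assms(1)] nth_map length_sort length_map)
qed

lemma order_stat_in:
  assumes "\<And>j. j \<in> {1..n} \<Longrightarrow> v j \<in> A" "i \<in> {1..n}"
  shows "order_stat n v i \<in> A"
proof -
  have "order_stat n v i \<in> set (sort (map v [1..<Suc n]))"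
    unfolding order_stat_def by (rule nth_mem) (use assms(2) in auto)
  then show ?thesis using assms(1) by auto
qed

lemma order_stat_mono:
  assumes "1 \<le> i" "i \<le> j" "j \<le> n"
  shows "order_stat n v i \<le> order_stat n v j"
  unfolding order_stat_def using assms by (intro sorted_nth_mono) auto

section \<open>The supremum of induced means\<close>

text \<open>For fixed \<open>z\<close>, summation by parts turns the mean into an affine function of
  the order statistics of \<open>u\<close>.\<close>

lemma continuous_on_induced_mean:
  assumes "1 \<le> n"
  shows "continuous_on UNIV (induced_mean E n z)"
proof -
  have eq: "induced_mean E n z = (\<lambda>u. Sup E -
      (\<Sum>i=1..n. order_stat n u i * (point E n z (i + 1) - point E n z i)))"
    by (rule ext) (rule induced_mean_alt[OF assms])
  show ?thesis
    unfolding eq by (intro continuous_intros continuous_on_order_stat)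
qed

text \<open>After summation by parts the levels enter with a minus sign and with the gaps between
  consecutive points of \<open>z\<close> as weights, which are nonnegative.\<close>

lemma induced_mean_antimono:
  assumes "1 \<le> n" "bdd_above E" "z \<in> {1..n} \<rightarrow>\<^sub>E E"
    and "\<And>i. i \<in> {1..n} \<Longrightarrow> order_stat n l i \<le> order_stat n u i"
  shows "induced_mean E n z u \<le> induced_mean E n z l"
  unfolding induced_mean_alt[OF assms(1)]
  using assms(4) point_mono[OF assms(3,2)]
  by (intro diff_left_mono sum_mono mult_right_mono) auto

text \<open>The \<open>Sup\<close> of an unbounded set of reals is a junk constant, so a pointwise supremum needs
  the unbounded region, a countable intersection of open sets, to be treated separately.\<close>

lemma borel_measurable_cSUP_continuous:
  fixes f :: "'i \<Rightarrow> 'a::topological_space \<Rightarrow> real"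
  assumes "S \<noteq> {}" and cont: "\<And>z. z \<in> S \<Longrightarrow> continuous_on UNIV (f z)"
  shows "(\<lambda>u. SUP z\<in>S. f z u) \<in> borel_measurable borel"
proof (rule borel_measurableI_le)
  fix a :: real
  define A where "A r = (\<Union>z\<in>S. {u. r < f z u})" for r
  define N where "N = (\<Inter>k::nat. A (real k))"
  \<comment> \<open>The value of \<open>Sup\<close> on a set without upper bound: \<open>Sup\<close>
    is the least upper bound via \<open>LEAST\<close>, and here no number satisfies the
    predicate.\<close>
  define c where "c = (LEAST w::real. False)"
  \<comment> \<open>\<open>S\<close> may be uncountable, so measurability of the union comes from
    openness.\<close>
  have "open (A r)" for r
    unfolding A_def by (intro open_UN ballI open_Collect_less continuous_on_const cont)
  then have A: "A r \<in> sets borel" for r by simp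
  then have N: "N \<in> sets borel" unfolding N_def by auto
  have bdd: "bdd_above ((\<lambda>z. f z u) ` S) \<longleftrightarrow> u \<notin> N" for u
  proof
    assume "bdd_above ((\<lambda>z. f z u) ` S)"
    then obtain w where w: "f z u \<le> w" if "z \<in> S" for z
      unfolding bdd_above_def by auto
    obtain k where "w \<le> real k" using real_arch_simple by blast
    then have "u \<notin> A (real k)" using w unfolding A_def by fastforce
    then show "u \<notin> N" unfolding N_def by blast
  next
    assume "u \<notin> N"
    then obtain k where "u \<notin> A (real k)" unfolding N_def by blast
    then show "bdd_above ((\<lambda>z. f z u) ` S)"
      unfolding A_def by (intro bdd_aboveI[of _ "real k"]) (auto simp: not_less)
  qed
  have "(SUP z\<in>S. f z u) \<le> a \<longleftrightarrow> u \<notin> A a" if "u \<notin> N" for u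
    using that bdd[of u] assms(1) by (subst cSUP_le_iff) (auto simp: A_def not_less)
  moreover have "(SUP z\<in>S. f z u) = c" if "u \<in> N" for u
  proof -
    have "(\<forall>y\<in>(\<lambda>z. f z u) ` S. y \<le> w) \<longleftrightarrow> False" for w
      using that bdd[of u] unfolding bdd_above_def by blast
    then show ?thesis unfolding Sup_real_def c_def by (simp only:)
  qed
  ultimately have "{u \<in> space borel. (SUP z\<in>S. f z u) \<le> a} =
      (if c \<le> a then N else {}) \<union> (- N \<inter> - A a)"
    by auto
  also have "\<dots> \<in> sets borel" using N A by auto
  finally show "{u \<in> space borel. (SUP z\<in>S. f z u) \<le> a} \<in> sets borel" .
qed

text \<open>Carries Borel measurability for the product topology on
  \<open>nat \<Rightarrow> real\<close> over to the product measure. The index type is countable, so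
  coordinates suffice; those outside \<open>I\<close> are constantly
  \<open>undefined\<close>.\<close>

lemma measurable_PiM_borel_fun:
  fixes M :: "nat \<Rightarrow> real measure"
  assumes "\<And>i. i \<in> I \<Longrightarrow> sets (M i) = sets borel"
  shows "(\<lambda>u. u) \<in> borel_measurable (PiM I M)"
proof (rule measurable_coordinatewise_then_product)
  fix i
  show "(\<lambda>u. u i) \<in> borel_measurable (PiM I M)"
  proof (cases "i \<in> I")
    case True
    have "(\<lambda>u. u i) \<in> measurable (PiM I M) (M i)"
      by (rule measurable_component_singleton[OF True])
    then show ?thesis using assms[OF True] measurable_cong_sets by blast
  next
    case False
    then show ?thesis
      by (subst measurable_cong[where g = "\<lambda>_. undefined"])
        (auto simp: space_PiM PiE_def extensional_def)
  qed
qed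

lemma measurable_sup_mean:
  assumes "1 \<le> n" "x \<in> {1..n} \<rightarrow>\<^sub>E E"
  shows "sup_mean E n T x \<in> borel_measurable (iid_uniform n)"
proof -
  have "x \<in> sublevel E n T x"
    using assms(2) by (simp add: sublevel_def)
  then have "(\<lambda>u. SUP z\<in>sublevel E n T x. induced_mean E n z u) \<in> borel_measurable borel"
    using continuous_on_induced_mean[OF assms(1)]
    by (intro borel_measurable_cSUP_continuous) auto
  moreover have "(\<lambda>u. u) \<in> borel_measurable (iid_uniform n)"
    unfolding iid_uniform_def by (rule measurable_PiM_borel_fun) simp
  ultimately show ?thesis
    unfolding sup_mean_def[abs_def] by (rule measurable_compose[rotated])
qed

text \<open>The point \<open>y\<close> belongs to the set whose \<open>Inf\<close> is the quantile.
  That set is bounded below because \<open>p > 0\<close> and the CDF tends to 0 at minus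
  infinity.\<close>

lemma quantile_le:
  assumes "prob_space M" and [measurable]: "Y \<in> borel_measurable M"
    and "0 < p" "p \<le> measure M {u \<in> space M. Y u \<le> y}"
  shows "quantile M p Y \<le> y"
proof -
  interpret M: prob_space M by fact
  interpret D: real_distribution "distr M borel Y"
    by (auto simp: real_distribution_def real_distribution_axioms_def intro!: M.prob_space_distr)
  have "Y -` {..y} \<inter> space M = {u \<in> space M. Y u \<le> y}" by auto
  then have "cdf (distr M borel Y) y \<ge> p"
    using assms(4) by (simp add: cdf_def measure_distr)
  moreover have "\<forall>\<^sub>F t in at_bot. cdf (distr M borel Y) t < p"
    using D.cdf_lim_at_bot assms(3) by (rule order_tendstoD)
  then obtain t where t: "cdf (distr M borel Y) t < p"
    by (auto simp: eventually_at_bot_linorder)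
  have "bdd_below {y. cdf (distr M borel Y) y \<ge> p}"
  proof (rule bdd_belowI)
    fix y assume "y \<in> {y. cdf (distr M borel Y) y \<ge> p}"
    then have "\<not> cdf (distr M borel Y) y \<le> cdf (distr M borel Y) t"
      using t by auto
    then show "t \<le> y" using D.cdf_nondecreasing[of y t] by linarith
  qed
  ultimately show ?thesis
    unfolding quantile_def by (intro cInf_lower) auto
qed

section \<open>The uniform distribution on \<open>[b - 1, b]\<close>\<close>

definition unif01 :: "real measure" where
  "unif01 = uniform_measure lborel {0..1}"

lemma sets_unif01 [simp, measurable_cong]: "sets unif01 = sets borel"
  by (simp add: unif01_def)

lemma space_unif01 [simp]: "space unif01 = UNIV"
  by (simp add: unif01_def)

lemma prob_space_unif01: "prob_space unif01"
  unfolding unif01_def by (rule prob_space_uniform_measure) auto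

lemma AE_unif01: "AE u in unif01. u \<in> {0..1}"
  unfolding unif01_def by (rule AE_uniform_measureI) auto

definition shift_unif :: "real \<Rightarrow> real measure" where
  "shift_unif b = distr unif01 borel (\<lambda>u. b - 1 + u)"

lemma cdf_shift_unif:
  assumes "s \<in> {0..1}"
  shows "cdf (shift_unif b) (b - 1 + s) = s"
proof -
  have "(\<lambda>u. b - 1 + u) -` {..b - 1 + s} \<inter> space unif01 = {..s}" by auto
  moreover have "{0..1} \<inter> {..s} = {0..s}" using assms by auto
  ultimately show ?thesis
    using assms
    by (simp add: cdf_def shift_unif_def measure_distr unif01_def measure_uniform_measure)
qed

lemma distribution_on_shift_unif: "distribution_on {..b} (shift_unif b)"
proof -
  interpret prob_space unif01 by (rule prob_space_unif01)
  have "prob_space (shift_unif b)"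
    unfolding shift_unif_def by (rule prob_space_distr) simp
  moreover have "AE y in shift_unif b. y \<in> {..b}"
    unfolding shift_unif_def using AE_unif01 by (subst AE_distr_iff) auto
  moreover have "sets (shift_unif b) = sets borel"
    by (simp add: shift_unif_def)
  ultimately show ?thesis
    by (simp add: distribution_on_def real_distribution_def real_distribution_axioms_def)
qed

text \<open>At \<open>t = b - 1 + order_stat n u i\<close> the CDF equals the \<open>i\<close>-th
  order statistic of \<open>u\<close>, while the step bound equals the \<open>j\<close>-th level of
  \<open>l\<close> for some \<open>j \<ge> i\<close>.\<close>

lemma order_stat_le_if_covered:
  assumes "1 \<le> n" and l: "l \<in> {1..n} \<rightarrow>\<^sub>E {0..1}"
    and u: "\<And>i. i \<in> {1..n} \<Longrightarrow> u i \<in> {0..1}"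
    and X: "X = compose {1..n} (\<lambda>u. b - 1 + u) u"
    and cov: "\<And>t. step_bound {..b} n X l t \<le> cdf (shift_unif b) t"
    and i: "i \<in> {1..n}"
  shows "order_stat n l i \<le> order_stat n u i"
proof -
  let ?t = "b - 1 + order_stat n u i"
  have X_stat: "order_stat n X j = b - 1 + order_stat n u j" if "j \<in> {1..n}" for j
    unfolding X using that by (intro order_stat_compose) (auto simp: mono_def)
  have u_stat: "order_stat n u i \<in> {0..1}" by (rule order_stat_in[OF u i])
  have l_stat: "order_stat n l i \<in> {0..1}" by (rule order_stat_in[OF _ i]) (use l in auto)
  have X_in: "X \<in> {1..n} \<rightarrow>\<^sub>E {..b}" unfolding X compose_def using u by fastforce
  show ?thesis
  proof (cases "order_stat n u i = 1")
    case True
    then show ?thesis using l_stat by auto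
  next
    case False
    \<comment> \<open>With ties in the sample, \<open>?t\<close> lies in the step interval of the
      last tied index, so \<open>j\<close> may exceed \<open>i\<close>.\<close>
    let ?J = "{j \<in> {1..n}. point {..b} n X j \<le> ?t}"
    define j where "j = Max ?J"
    have "i \<in> ?J" using i X_stat[OF i] by (auto simp: point_def)
    moreover have fin: "finite ?J" by simp
    ultimately have j: "j \<in> ?J" "i \<le> j"
      unfolding j_def using Max_in[OF fin] Max_ge[OF fin] by blast+
    have "?t < point {..b} n X (j + 1)"
    proof (cases "j = n")
      case True
      \<comment> \<open>The next point is \<open>Sup {..b} = b\<close>, and \<open>?t < b\<close>
        because the order statistic of \<open>u\<close> is below 1.\<close>
      then show ?thesis using u_stat False by (auto simp: point_def)
    next
      case False
      then have "j + 1 \<notin> ?J" using Max_ge[OF fin, of "j + 1"] unfolding j_def by linarith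
      then show ?thesis using False j by auto
    qed
    then have "order_stat n l j = step_bound {..b} n X l ?t"
      using step_bound_mid[OF X_in _ _ , of j ?t l] j by auto
    also have "\<dots> \<le> order_stat n u i"
      using cov[of ?t] cdf_shift_unif[OF u_stat, of b] by simp
    finally show ?thesis
      using order_stat_mono[of i j n l] i j by auto
  qed
qed

section \<open>Transfer of the coverage to the uniform vector and comparison of the bounds\<close>

theorem theorem4p3:
  fixes b \<alpha> :: real and D :: "real set" and n :: nat and l x :: "nat \<Rightarrow> real"
  assumes "D \<subseteq> {..b}"
    and "1 \<le> n"
    and "0 < \<alpha>" and "\<alpha> < 1"
    and "l \<in> {1..n} \<rightarrow>\<^sub>E {0..1}"
    and "exact_lower_conf_bound {..b} n \<alpha> (\<lambda>X. step_bound {..b} n X l)"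
    and "x \<in> {1..n} \<rightarrow>\<^sub>E D"
  shows "mean_upper_bound {..b} n \<alpha> (anderson_bound b n l) x \<le> anderson_bound b n l x"
proof -
  let ?T = "anderson_bound b n l"
  let ?Y = "sup_mean {..b} n ?T x"
  let ?f = "\<lambda>u::real. b - 1 + u"
  let ?P = "\<Pi>\<^sub>M i\<in>{1..n}. shift_unif b"
  let ?cov = "\<lambda>X. \<forall>t. step_bound {..b} n X l t \<le> cdf (shift_unif b) t"
  let ?A = "{X \<in> space ?P. ?cov X}"
  have U: "iid_uniform n = (\<Pi>\<^sub>M i\<in>{1..n}. unif01)"
    by (simp add: iid_uniform_def unif01_def)
  have prob: "prob_space (iid_uniform n)"
    unfolding U by (intro prob_space_PiM prob_space_unif01)
  interpret prob_space "iid_uniform n" by (rule prob)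
  have x: "x \<in> {1..n} \<rightarrow>\<^sub>E {..b}" using assms(1,7) by auto
  note [measurable] = measurable_sup_mean[OF \<open>1 \<le> n\<close> x, of ?T]
  \<comment> \<open>The shifted uniform vector is an i.i.d. sample from \<open>shift_unif b\<close>;
    \<open>compose\<close> keeps it extensional, as the product space requires.\<close>
  have P: "?P = distr (iid_uniform n) (\<Pi>\<^sub>M i\<in>{1..n}. shift_unif b) (compose {1..n} ?f)"
  proof -
    have "distr (iid_uniform n) (\<Pi>\<^sub>M i\<in>{1..n}. shift_unif b) (compose {1..n} ?f)
        = (\<Pi>\<^sub>M i\<in>{1..n}. distr unif01 (shift_unif b) ?f)"
      unfolding U using distribution_on_shift_unif[of b]
      by (intro distr_PiM_finite_prob_space' prob_space_unif01)
        (auto simp: shift_unif_def distribution_on_def real_distribution_def)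
    also have "distr unif01 (shift_unif b) ?f = shift_unif b"
      unfolding shift_unif_def by (rule distr_cong) auto
    finally show ?thesis by simp
  qed
  have [measurable]: "compose {1..n} ?f \<in> measurable (iid_uniform n) ?P"
    unfolding U compose_def shift_unif_def by measurable
  have cov: "1 - \<alpha> \<le> measure ?P ?A"
    using assms(6) distribution_on_shift_unif[of b]
    by (auto simp: exact_lower_conf_bound_def lower_conf_bound_def coverage_def)
  text \<open>A nonmeasurable set would have measure \<open>0\<close>.\<close>
  have A: "?A \<in> sets ?P"
  proof (rule ccontr)
    assume "?A \<notin> sets ?P"
    then have "measure ?P ?A = 0" by (rule measure_notin_sets)
    then show False using cov \<open>\<alpha> < 1\<close> by linarith
  qed
  have AE_unit: "AE u in iid_uniform n. \<forall>i\<in>{1..n}. u i \<in> {0..1}"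
    unfolding U
    by (intro AE_finite_allI AE_PiM_component[where P = "\<lambda>u. u \<in> {0..1}"] AE_unif01 prob_space_unif01) auto
  note cov
  also have "measure ?P ?A
      = prob (compose {1..n} ?f -` ?A \<inter> space (iid_uniform n))"
    by (subst P) (rule measure_distr[OF _ A], measurable)
  \<comment> \<open>The inclusion of events holds only almost everywhere, since domination of the
    levels needs \<open>u\<close> in the unit cube.\<close>
  also have "\<dots> \<le> prob {u \<in> space (iid_uniform n). ?Y u \<le> ?T x}"
  proof (rule finite_measure_mono_AE)
    show "AE u in iid_uniform n. u \<in> compose {1..n} ?f -` ?A \<inter> space (iid_uniform n) \<longrightarrow>
        u \<in> {u \<in> space (iid_uniform n). ?Y u \<le> ?T x}"
      using AE_unit
    proof eventually_elim
      case (elim u)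
      have "?Y u \<le> ?T x" if "?cov (compose {1..n} ?f u)"
      proof -
        have le: "order_stat n l i \<le> order_stat n u i" if "i \<in> {1..n}" for i
          using \<open>?cov _\<close> elim that
          by (intro order_stat_le_if_covered[OF \<open>1 \<le> n\<close> assms(5) _ refl, of u b]) auto
        show ?thesis
          unfolding sup_mean_def
        proof (rule cSUP_least)
          show "sublevel {..b} n ?T x \<noteq> {}" using x by (auto simp: sublevel_def)
          fix z assume z: "z \<in> sublevel {..b} n ?T x"
          \<comment> \<open>Domination replaces \<open>u\<close> by \<open>l\<close> for the same
            \<open>z\<close>; membership in the sublevel set of \<open>?T\<close> then passes from
            \<open>z\<close> to \<open>x\<close>.\<close>
          then have "induced_mean {..b} n z u \<le> ?T z"
            unfolding anderson_bound_def
            by (intro induced_mean_antimono \<open>1 \<le> n\<close> le) (auto simp: sublevel_def)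
          also have "\<dots> \<le> ?T x" using z by (simp add: sublevel_def)
          finally show "induced_mean {..b} n z u \<le> ?T x" .
        qed
      qed
      then show ?case by auto
    qed
  qed measurable
  finally show ?thesis
    unfolding mean_upper_bound_def using \<open>\<alpha> < 1\<close> prob
    by (intro quantile_le) auto
qed

end
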